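(* Let $\Gamma\subset\mathbb{S}^2_1$ be a noncharacteristic curve with unit conormal $\nu$, $\langle\nu,\nu\rangle=\delta\in\{-1,1\}$. Let $u$ solve $\Box_{\mathbb{S}^2_1}u+2u=0$ and satisfy $$u=a,\qquad \partial_\nu u=b\qquad\text{on }\Gamma$$ for constants $a,b\in\mathbb{R}$. Set $\rho=a^2+\delta b^2$ and $X_u(p)=u(p)\,p+\nabla u(p)$. Where $X_u$ is regular along $\Gamma$, its boundary (the image of $\Gamma$) lies on $$\mathcal{Q}_\rho=\{x\in\mathbb{L}^3:\langle x,x\rangle=\rho\}.$$ If $\rho\neq0$, this is a nondegenerate totally umbilical quadric and $X_u$ meets it at constant Lorentzian contact angle. If $\rho=0$, the boundary lies on the light cone.
   Context: $\mathbb{L}^3=(\mathbb{R}^3,\langle\,,\,\rangle)$ is Lorentz--Minkowski space of signature $(+,+,-)$, and the de Sitter plane is $\mathbb{S}^2_1=\{p\in\mathbb{L}^3:\langle p,p\rangle=1\}$ with the induced Lorentzian metric. $\nabla u$ is the intrinsic gradient, regarded as a vector in $T_p\mathbb{S}^2_1=p^\perp\subset\mathbb{L}^3$; $\operatorname{Hess}u(Y)=\nabla_Y\nabla u$; $\Box_{\mathbb{S}^2_1}$ is the metric trace of the Hessian. The function $u$ is of class $C^2$ on a domain containing $\Gamma$. A curve is noncharacteristic if it is nowhere null; a unit conormal $\nu$ is a chosen unit normal field along $\Gamma$ tangent to $\mathbb{S}^2_1$, and $\partial_\nu u=du(\nu)$. $X_u$ is regular at $p$ if $\det(\operatorname{Hess}u+u\operatorname{Id})(p)\neq0$;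 near such points $X_u$ is a timelike immersed surface with unit normal $p$ at $X_u(p)$. The light cone is $\{x:\langle x,x\rangle=0\}$. "Constant Lorentzian contact angle" with $\mathcal{Q}_\rho$ ($\rho\ne0$) means that the Lorentzian product of the unit normal of the surface and the unit normal $x/\sqrt{|\rho|}$ of $\mathcal{Q}_\rho$ is constant along the boundary. *)

theory Defs
  imports "HOL-Analysis.Analysis"
begin

section \<open>Lorentz--Minkowski space and the de Sitter plane\<close>

definition lorentz :: "real^3 \<Rightarrow> real^3 \<Rightarrow> real" (infix "\<bullet>\<^sub>L" 70) where
  "x \<bullet>\<^sub>L y = x $ 1 * y $ 1 + x $ 2 * y $ 2 - x $ 3 * y $ 3"

definition quadric :: "real \<Rightarrow> (real^3) set" where
  "quadric \<rho> = {x. x \<bullet>\<^sub>L x = \<rho>}"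

definition light_cone :: "(real^3) set" where
  "light_cone = {x. x \<bullet>\<^sub>L x = 0}"

definition deSitter :: "(real^3) set" where
  "deSitter = {p. p \<bullet>\<^sub>L p = 1}"

definition dS_tangent :: "real^3 \<Rightarrow> (real^3) set" where
  "dS_tangent p = {v. v \<bullet>\<^sub>L p = 0}"

section \<open>Differentiability classes\<close>

text \<open>On an open subset of a Euclidean space: all partial derivatives up to order \<open>k\<close> exist
  (as Frechet derivatives) and are continuous.\<close>

primrec Ck_on :: "nat \<Rightarrow> ('a::euclidean_space \<Rightarrow> 'b::real_normed_vector) \<Rightarrow> 'a set \<Rightarrow> bool" where
  "Ck_on 0 f U \<longleftrightarrow> continuous_on U f"
| "Ck_on (Suc k) f U \<longleftrightarrow>
     (\<exists>f'. (\<forall>x\<in>U. (f has_derivative f' x) (at x)) \<and> (\<forall>v. Ck_on k (\<lambda>x. f' x v) U))"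

text \<open>On a subset such as a surface: locally the restriction of an ambient \<open>C\<^sup>k\<close> function.\<close>

definition Ck_on_subset :: "nat \<Rightarrow> (real^3 \<Rightarrow> real) \<Rightarrow> (real^3) set \<Rightarrow> bool" where
  "Ck_on_subset k f A \<longleftrightarrow>
     (\<forall>p\<in>A. \<exists>W F. open W \<and> p \<in> W \<and> Ck_on k F W \<and> (\<forall>x\<in>W \<inter> A. F x = f x))"

section \<open>Calculus on the de Sitter plane\<close>

text \<open>A Frechet derivative within \<open>deSitter\<close> is determined only on \<open>dS_tangent p\<close>, so
  \<open>dS_diff f p v\<close> is meaningful only for tangent \<open>v\<close>.\<close>

definition dS_diff :: "(real^3 \<Rightarrow> 'b::real_normed_vector) \<Rightarrow> real^3 \<Rightarrow> real^3 \<Rightarrow> 'b" where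
  "dS_diff f p = frechet_derivative f (at p within deSitter)"

definition grad :: "(real^3 \<Rightarrow> real) \<Rightarrow> real^3 \<Rightarrow> real^3" where
  "grad u p = (THE g. g \<in> dS_tangent p \<and> (\<forall>v\<in>dS_tangent p. g \<bullet>\<^sub>L v = dS_diff u p v))"

text \<open>The Levi-Civita connection of the induced metric is the tangential part of the ambient
  derivative; \<open>p\<close> itself is the unit normal of the de Sitter plane at \<open>p\<close>.\<close>

definition dS_conn :: "(real^3 \<Rightarrow> real^3) \<Rightarrow> real^3 \<Rightarrow> real^3 \<Rightarrow> real^3" where
  "dS_conn V p Y = dS_diff V p Y - (dS_diff V p Y \<bullet>\<^sub>L p) *\<^sub>R p"

definition Hess :: "(real^3 \<Rightarrow> real) \<Rightarrow> real^3 \<Rightarrow> real^3 \<Rightarrow> real^3" where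
  "Hess u p Y = dS_conn (grad u) p Y"

text \<open>Trace and determinant of an endomorphism \<open>A\<close> of the tangent plane at \<open>p\<close>: the common
  value over all orthonormal frames and over all bases, respectively.\<close>

definition metric_trace :: "real^3 \<Rightarrow> (real^3 \<Rightarrow> real^3) \<Rightarrow> real" where
  "metric_trace p A = (THE t. \<forall>e1\<in>dS_tangent p. \<forall>e2\<in>dS_tangent p.
     e1 \<bullet>\<^sub>L e1 = 1 \<and> e2 \<bullet>\<^sub>L e2 = -1 \<and> e1 \<bullet>\<^sub>L e2 = 0 \<longrightarrow> t = A e1 \<bullet>\<^sub>L e1 - A e2 \<bullet>\<^sub>L e2)"

definition tangent_det :: "real^3 \<Rightarrow> (real^3 \<Rightarrow> real^3) \<Rightarrow> real" where
  "tangent_det p A = (THE d. \<forall>(e :: 2 \<Rightarrow> real^3) (M :: real^2^2).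
     inj e \<and> independent (range e) \<and> span (range e) = dS_tangent p \<and>
     (\<forall>j. A (e j) = (\<Sum>i\<in>UNIV. M $ i $ j *\<^sub>R e i)) \<longrightarrow> det M = d)"

definition dAlembertian :: "(real^3 \<Rightarrow> real) \<Rightarrow> real^3 \<Rightarrow> real" where
  "dAlembertian u p = metric_trace p (Hess u p)"

definition X_map :: "(real^3 \<Rightarrow> real) \<Rightarrow> real^3 \<Rightarrow> real^3" where
  "X_map u p = u p *\<^sub>R p + grad u p"

definition X_regular_at :: "(real^3 \<Rightarrow> real) \<Rightarrow> real^3 \<Rightarrow> bool" where
  "X_regular_at u p \<longleftrightarrow> tangent_det p (\<lambda>Y. Hess u p Y + u p *\<^sub>R Y) \<noteq> 0"

definition regular_part :: "(real^3 \<Rightarrow> real) \<Rightarrow> (real^3) set \<Rightarrow> (real^3) set" where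
  "regular_part u C = {p \<in> C. X_regular_at u p}"

section \<open>Curves in the de Sitter plane\<close>

text \<open>Curves are parametrized by an arbitrary nondegenerate interval \<open>I\<close>, with one-sided
  derivatives at endpoints belonging to \<open>I\<close>. Self-intersections are allowed, so fields along the
  curve depend on the parameter.\<close>

definition noncharacteristic_curve :: "real set \<Rightarrow> (real \<Rightarrow> real^3) \<Rightarrow> bool" where
  "noncharacteristic_curve I \<gamma> \<longleftrightarrow>
     is_interval I \<and> interior I \<noteq> {} \<and> \<gamma> ` I \<subseteq> deSitter \<and>
     (\<forall>t\<in>I. \<gamma> differentiable (at t within I)) \<and>
     continuous_on I (\<lambda>t. vector_derivative \<gamma> (at t within I)) \<and>
     (\<forall>t\<in>I. vector_derivative \<gamma> (at t within I) \<bullet>\<^sub>L vector_derivative \<gamma> (at t within I) \<noteq> 0)"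

definition unit_conormal :: "real set \<Rightarrow> (real \<Rightarrow> real^3) \<Rightarrow> real \<Rightarrow> (real \<Rightarrow> real^3) \<Rightarrow> bool" where
  "unit_conormal I \<gamma> \<delta> \<nu> \<longleftrightarrow>
     continuous_on I \<nu> \<and>
     (\<forall>t\<in>I. \<nu> t \<in> dS_tangent (\<gamma> t) \<and> \<nu> t \<bullet>\<^sub>L vector_derivative \<gamma> (at t within I) = 0 \<and>
            \<nu> t \<bullet>\<^sub>L \<nu> t = \<delta>)"

section \<open>Surfaces in Lorentz--Minkowski space\<close>

definition tangent_space :: "(real^3) set \<Rightarrow> real^3 \<Rightarrow> (real^3) set" where
  "tangent_space S x = {v. \<exists>c \<epsilon>. \<epsilon> > 0 \<and> c (0::real) = x \<and> (\<forall>t. \<bar>t\<bar> < \<epsilon> \<longrightarrow> c t \<in> S) \<and>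
     (c has_vector_derivative v) (at 0)}"

definition regular_surface :: "(real^3) set \<Rightarrow> bool" where
  "regular_surface S \<longleftrightarrow>
     (\<forall>x\<in>S. \<exists>U (F :: real^3 \<Rightarrow> real). open U \<and> x \<in> U \<and> (\<forall>k. Ck_on k F U) \<and>
        S \<inter> U = {y\<in>U. F y = 0} \<and> (\<forall>y\<in>S \<inter> U. frechet_derivative F (at y) \<noteq> (\<lambda>_. 0)))"

definition quadric_surface :: "(real^3) set \<Rightarrow> bool" where
  "quadric_surface S \<longleftrightarrow> S \<noteq> {} \<and> regular_surface S \<and>
     (\<exists>(A :: real^3^3) (w :: real^3) c. A \<noteq> 0 \<and> transpose A = A \<and>
        S = {x. x \<bullet> (A *v x) + w \<bullet> x + c = 0})"

definition nondegenerate :: "(real^3) set \<Rightarrow> bool" where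
  "nondegenerate S \<longleftrightarrow>
     (\<forall>x\<in>S. \<forall>v\<in>tangent_space S x. (\<forall>w\<in>tangent_space S x. v \<bullet>\<^sub>L w = 0) \<longrightarrow> v = 0)"

definition unit_normal_field :: "(real^3) set \<Rightarrow> (real^3 \<Rightarrow> real^3) \<Rightarrow> bool" where
  "unit_normal_field S M \<longleftrightarrow> continuous_on S M \<and>
     (\<forall>x\<in>S. \<bar>M x \<bullet>\<^sub>L M x\<bar> = 1 \<and> (\<forall>v\<in>tangent_space S x. M x \<bullet>\<^sub>L v = 0))"

text \<open>The shape operator of a local unit normal field is, at each point, a multiple of the
  identity.\<close>

definition totally_umbilical :: "(real^3) set \<Rightarrow> bool" where
  "totally_umbilical S \<longleftrightarrow>
     (\<forall>x\<in>S. \<exists>U M. open U \<and> x \<in> U \<and> unit_normal_field (S \<inter> U) M \<and>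
        (\<forall>y\<in>S \<inter> U. \<exists>D \<kappa>. (M has_derivative D) (at y within S) \<and>
           (\<forall>v\<in>tangent_space S y. D v = \<kappa> *\<^sub>R v)))"

text \<open>\<open>X\<close> maps (part of) the de Sitter plane to a surface; a plane is timelike iff it contains
  a timelike vector. \<open>n\<close> is a unit normal of the surface at \<open>X p\<close>.\<close>

definition timelike_immersion_with_normal_at ::
    "(real^3 \<Rightarrow> real^3) \<Rightarrow> real^3 \<Rightarrow> real^3 \<Rightarrow> bool" where
  "timelike_immersion_with_normal_at X p n \<longleftrightarrow>
     (\<exists>D. (X has_derivative D) (at p within deSitter) \<and> inj_on D (dS_tangent p) \<and>
        (\<exists>v\<in>dS_tangent p. D v \<bullet>\<^sub>L D v < 0) \<and>
        n \<bullet>\<^sub>L n = 1 \<and> (\<forall>v\<in>dS_tangent p. n \<bullet>\<^sub>L D v = 0))"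

text \<open>\<open>N\<close> is the unit normal of the surface \<open>X\<close>, \<open>M\<close> that of \<open>S\<close>, and \<open>C\<close> the curve (in the
  parameter domain) along which the two surfaces meet.\<close>

definition meets_at_constant_angle :: "(real^3 \<Rightarrow> real^3) \<Rightarrow> (real^3 \<Rightarrow> real^3) \<Rightarrow> (real^3) set \<Rightarrow>
    (real^3) set \<Rightarrow> (real^3 \<Rightarrow> real^3) \<Rightarrow> bool" where
  "meets_at_constant_angle X N C S M \<longleftrightarrow>
     (\<forall>p\<in>C. timelike_immersion_with_normal_at X p (N p)) \<and> unit_normal_field S M \<and>
     X ` C \<subseteq> S \<and> (\<exists>c. \<forall>p\<in>C. N p \<bullet>\<^sub>L M (X p) = c)"

end

theory Submission
  imports Defs
begin

text \<open>Along \<open>\<gamma>\<close> the vectors \<open>\<gamma> t\<close>, \<open>\<gamma>' t\<close> and \<open>\<nu> t\<close> are pairwise orthogonal and none of them is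
  null, so they form a frame of Lorentz--Minkowski space. The gradient of \<open>u\<close> is orthogonal to the
  first, being tangent to the de Sitter plane, and to the second, because \<open>u\<close> is constant on the
  curve. Hence it is the multiple \<open>\<delta> b \<nu> t\<close> of the third, and \<open>X_u = a \<gamma> t + \<delta> b \<nu> t\<close> has square
  \<open>a\<^sup>2 + \<delta> b\<^sup>2\<close> (lemma \<open>X_map_in_quadric\<close>). The normal of the surface at \<open>X_u(p)\<close> is \<open>p\<close> itself,
  and \<open>p \<bullet>\<^sub>L X_u(p) = u(p)\<close>; this equals \<open>a\<close> on the curve, which is why the contact angle is
  constant.

  That \<open>p\<close> is the normal follows from \<open>dX_u = Hess u + u Id\<close> on the tangent plane at \<open>p\<close>:
  differentiating \<open>\<nabla>u(x) \<bullet>\<^sub>L x = 0\<close> shows that the normal component of the ambient derivative of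
  \<open>\<nabla>u\<close> cancels the term \<open>du p\<close> coming from the product \<open>u p\<close>. At a regular point \<open>dX_u\<close> is
  therefore an automorphism of the tangent plane, and the image plane is the tangent plane, which
  contains a timelike vector (lemma \<open>timelike_immersion_X_map\<close>).

  The geometry of the quadrics rests on the identification of the tangent space at \<open>x\<close> with the
  orthogonal complement of \<open>x\<close> (lemma \<open>tangent_space_quadric\<close>). It applies to the de Sitter plane
  as well, where it makes derivatives within the surface unique in tangent directions
  (lemma \<open>dS_derivative_unique\<close>).\<close>

section \<open>The Lorentz product\<close>

lemma bounded_bilinear_lorentz: "bounded_bilinear (\<bullet>\<^sub>L)"
proof -
  have "bounded_linear (\<lambda>y::real^3. vector [y $ 1, y $ 2, - y $ 3] :: real^3)"
    by (intro linear_linear[THEN iffD2] linearI) (auto simp: vec_eq_iff forall_3 vector_3)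
  from bounded_bilinear.comp[OF bounded_bilinear_inner bounded_linear_ident this]
  have "bounded_bilinear (\<lambda>x y::real^3. x \<bullet> (vector [y $ 1, y $ 2, - y $ 3] :: real^3) :: real)"
    by simp
  moreover have "(\<bullet>\<^sub>L) = (\<lambda>x y::real^3. x \<bullet> vector [y $ 1, y $ 2, - y $ 3])"
    by (auto simp: fun_eq_iff lorentz_def inner_vec_def sum_3 vector_3)
  ultimately show ?thesis by metis
qed

interpretation lorentz: bounded_bilinear "(\<bullet>\<^sub>L)"
  by (rule bounded_bilinear_lorentz)

lemma lorentz_commute: "x \<bullet>\<^sub>L y = y \<bullet>\<^sub>L x"
  by (simp add: lorentz_def)

lemma lorentz_nondegenerate:
  assumes "\<And>w. v \<bullet>\<^sub>L w = 0"
  shows "v = 0"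
  using assms[of "axis 1 1"] assms[of "axis 2 1"] assms[of "axis 3 1"]
  by (auto simp: lorentz_def axis_def vec_eq_iff forall_3)

text \<open>The vector representing a linear form with respect to the Lorentz product, in coordinates: the
  formula shows that the gradient depends differentiably on the point.\<close>

lemma lorentz_representation:
  assumes "linear f"
  shows "vector [f (axis 1 1), f (axis 2 1), - f (axis 3 1)] \<bullet>\<^sub>L v = f v"
proof -
  have "v = v $ 1 *\<^sub>R axis 1 1 + v $ 2 *\<^sub>R axis 2 1 + v $ 3 *\<^sub>R axis 3 1"
    by (auto simp: vec_eq_iff forall_3 axis_def)
  from arg_cong[OF this, of f]
  have "f v = v $ 1 *\<^sub>R f (axis 1 1) + v $ 2 *\<^sub>R f (axis 2 1) + v $ 3 *\<^sub>R f (axis 3 1)"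
    by (simp only: linear_add[OF assms] linear_scale[OF assms])
  then show ?thesis by (simp add: lorentz_def vector_3 mult.commute)
qed

text \<open>For non-null \<open>x\<close>, every vector is the sum of a multiple of \<open>x\<close> and a vector orthogonal to
  \<open>x\<close>, so orthogonality to both kinds of vectors is orthogonality to the whole space.\<close>

lemma perp_nondegenerate:
  assumes x: "x \<bullet>\<^sub>L x \<noteq> 0" and v: "v \<bullet>\<^sub>L x = 0"
    and orth: "\<And>w. w \<bullet>\<^sub>L x = 0 \<Longrightarrow> v \<bullet>\<^sub>L w = 0"
  shows "v = 0"
proof (rule lorentz_nondegenerate)
  fix w
  let ?c = "(w \<bullet>\<^sub>L x) / (x \<bullet>\<^sub>L x)"
  have "(w - ?c *\<^sub>R x) \<bullet>\<^sub>L x = 0"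
    using x by (simp add: lorentz.diff_left lorentz.scaleR_left)
  from orth[OF this] show "v \<bullet>\<^sub>L w = 0"
    using v by (simp add: lorentz.diff_right lorentz.scaleR_right)
qed

text \<open>Pairwise orthogonal non-null vectors are linearly independent, hence three of them form a
  basis. In matrix form: the matrix with these rows is invertible, and it annihilates the vector
  obtained from \<open>h\<close> by changing the sign of the last coordinate.\<close>

lemma orthogonal_to_frame_eq_0:
  assumes p: "p \<bullet>\<^sub>L p \<noteq> 0" and T: "T \<bullet>\<^sub>L T \<noteq> 0" and n: "n \<bullet>\<^sub>L n \<noteq> 0"
    and orth: "p \<bullet>\<^sub>L T = 0" "p \<bullet>\<^sub>L n = 0" "T \<bullet>\<^sub>L n = 0"
    and h: "h \<bullet>\<^sub>L p = 0" "h \<bullet>\<^sub>L T = 0" "h \<bullet>\<^sub>L n = 0"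
  shows "h = 0"
proof -
  let ?B = "vector [p, T, n] :: real^3^3"
  have flip: "T \<bullet>\<^sub>L p = 0" "n \<bullet>\<^sub>L p = 0" "n \<bullet>\<^sub>L T = 0"
    using orth by (simp_all add: lorentz_commute)
  have "c = 0" if "c v* ?B = 0" for c :: "real^3"
  proof -
    have s: "c $ 1 *\<^sub>R p + c $ 2 *\<^sub>R T + c $ 3 *\<^sub>R n = 0"
      using that
      by (simp add: vec_eq_iff forall_3 vector_matrix_mult_def sum_3 vector_3 mult.commute)
    have "c $ 1 * (p \<bullet>\<^sub>L p) = 0"
      using arg_cong[OF s, of "\<lambda>x. x \<bullet>\<^sub>L p"] flip
      by (simp add: lorentz.add_left lorentz.scaleR_left lorentz.zero_left)
    moreover have "c $ 2 * (T \<bullet>\<^sub>L T) = 0"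
      using arg_cong[OF s, of "\<lambda>x. x \<bullet>\<^sub>L T"] flip orth
      by (simp add: lorentz.add_left lorentz.scaleR_left lorentz.zero_left)
    moreover have "c $ 3 * (n \<bullet>\<^sub>L n) = 0"
      using arg_cong[OF s, of "\<lambda>x. x \<bullet>\<^sub>L n"] flip orth
      by (simp add: lorentz.add_left lorentz.scaleR_left lorentz.zero_left)
    ultimately show ?thesis using p T n by (simp add: vec_eq_iff forall_3)
  qed
  then have "\<forall>c. transpose ?B *v c = 0 \<longrightarrow> c = 0"
    by (simp add: transpose_matrix_vector)
  then have "invertible (transpose ?B)"
    by (simp add: invertible_left_inverse matrix_left_invertible_ker)
  then have "invertible ?B" by (simp add: invertible_det_nz)
  then have inj: "?B *v y = 0 \<Longrightarrow> y = 0" for y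
    using invertible_left_inverse matrix_left_invertible_ker by blast
  let ?Jh = "vector [h $ 1, h $ 2, - h $ 3] :: real^3"
  have "?B *v ?Jh = 0"
    using h by (simp add: vec_eq_iff forall_3 matrix_vector_mult_def sum_3 vector_3 lorentz_def
        mult.commute)
  from inj[OF this] show ?thesis by (simp add: vec_eq_iff forall_3 vector_3)
qed

section \<open>Central quadrics\<close>

text \<open>Stated for derivatives within a set of parameters, so that it covers both curves on an open
  interval and the one-sided derivatives at an endpoint.\<close>

lemma quadric_curve_normal:
  assumes I: "t \<in> I" "at t within I \<noteq> bot" and c: "\<And>s. s \<in> I \<Longrightarrow> c s \<in> quadric \<rho>"
    and v: "(c has_vector_derivative v) (at t within I)"
  shows "v \<bullet>\<^sub>L c t = 0"
proof -
  have "((\<lambda>s. c s \<bullet>\<^sub>L c s) has_vector_derivative c t \<bullet>\<^sub>L v + v \<bullet>\<^sub>L c t) (at t within I)"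
    using lorentz.has_vector_derivative[OF v v] by simp
  moreover have "((\<lambda>s. c s \<bullet>\<^sub>L c s) has_vector_derivative 0) (at t within I)"
    by (rule has_vector_derivative_transform[OF I(1) _ has_vector_derivative_const[of \<rho>]])
      (use c in \<open>auto simp: quadric_def\<close>)
  ultimately have "c t \<bullet>\<^sub>L v + v \<bullet>\<^sub>L c t = 0"
    using vector_derivative_unique_within[OF I(2)] by blast
  then show ?thesis by (simp add: lorentz_commute)
qed

text \<open>A vector \<open>v\<close> orthogonal to \<open>x\<close> is the velocity of the line \<open>x + t v\<close> projected radially
  back to the quadric.\<close>

lemma tangent_space_quadric:
  assumes "\<rho> \<noteq> 0" and x: "x \<in> quadric \<rho>"
  shows "tangent_space (quadric \<rho>) x = {v. v \<bullet>\<^sub>L x = 0}"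
proof (intro equalityI subsetI)
  fix v assume "v \<in> tangent_space (quadric \<rho>) x"
  then obtain c e where e: "e > 0" "c 0 = x" "\<And>t. \<bar>t\<bar> < e \<Longrightarrow> c t \<in> quadric \<rho>"
    and d: "(c has_vector_derivative v) (at (0::real))"
    unfolding tangent_space_def by blast
  have "v \<bullet>\<^sub>L c 0 = 0"
  proof (rule quadric_curve_normal[where \<rho> = \<rho>])
    show "(c has_vector_derivative v) (at 0 within {-e<..<e})"
      using d by (rule has_vector_derivative_at_within)
    show "at 0 within {-e<..<e} \<noteq> bot"
      using e(1) by (simp add: at_within_open[of 0 "{-e<..<e}"])
  qed (use e in auto)
  then show "v \<in> {v. v \<bullet>\<^sub>L x = 0}" using e by simp
next
  fix v assume "v \<in> {v. v \<bullet>\<^sub>L x = 0}"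
  then have v: "v \<bullet>\<^sub>L x = 0" "x \<bullet>\<^sub>L v = 0" by (simp_all add: lorentz_commute)
  \<comment> \<open>The square of \<open>x + t v\<close> is \<open>\<rho> q(t)\<close>, so dividing by \<open>sqrt (q t)\<close> restores the square \<open>\<rho>\<close>.\<close>
  define q where "q t = 1 + t\<^sup>2 * (v \<bullet>\<^sub>L v) / \<rho>" for t
  define c where "c t = (1 / sqrt (q t)) *\<^sub>R (x + t *\<^sub>R v)" for t
  have "isCont q 0" unfolding q_def by (intro continuous_intros) (use assms in auto)
  moreover have "q 0 > 0" by (simp add: q_def)
  ultimately have "eventually (\<lambda>t. q t > 0) (at 0)"
    by (metis isCont_def order_tendstoD(1))
  then obtain e where e: "e > 0" "\<And>t. \<bar>t\<bar> < e \<Longrightarrow> q t > 0"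
    using \<open>q 0 > 0\<close> unfolding eventually_at
    by (metis UNIV_I dist_real_def diff_zero)
  have "c t \<in> quadric \<rho>" if "\<bar>t\<bar> < e" for t
  proof -
    have "(x + t *\<^sub>R v) \<bullet>\<^sub>L (x + t *\<^sub>R v) = \<rho> * q t"
      using v x assms(1)
      by (simp add: q_def quadric_def lorentz.add_left lorentz.add_right lorentz.scaleR_left
          lorentz.scaleR_right field_simps power2_eq_square)
    then have "c t \<bullet>\<^sub>L c t = \<rho> * q t / (sqrt (q t) * sqrt (q t))"
      unfolding c_def lorentz.scaleR_left lorentz.scaleR_right by simp
    also have "sqrt (q t) * sqrt (q t) = q t" using e(2)[OF that] by simp
    also have "\<rho> * q t / q t = \<rho>" using e(2)[OF that] by simp
    finally show ?thesis by (simp add: quadric_def)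
  qed
  moreover have "(c has_vector_derivative v) (at 0)"
  proof -
    have "(q has_real_derivative 0) (at 0)"
      unfolding q_def using assms(1) by (auto intro!: derivative_eq_intros)
    then have "((\<lambda>t. 1 / sqrt (q t)) has_real_derivative 0) (at 0)"
      using \<open>q 0 > 0\<close> by (auto intro!: derivative_eq_intros)
    moreover have "((\<lambda>t. x + t *\<^sub>R v) has_vector_derivative v) (at 0)"
      by (auto intro!: derivative_eq_intros)
    ultimately have "(c has_vector_derivative (1 / sqrt (q 0)) *\<^sub>R v + 0 *\<^sub>R (x + 0 *\<^sub>R v)) (at 0)"
      unfolding c_def
      by (rule has_vector_derivative_scaleR)
    then show ?thesis by (simp add: q_def)
  qed
  moreover have "c 0 = x" by (simp add: c_def q_def)
  ultimately show "v \<in> tangent_space (quadric \<rho>) x"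
    unfolding tangent_space_def using e(1) by blast
qed

lemma Ck_on_const: "Ck_on k (\<lambda>_. c) U"
  by (induction k arbitrary: c) (auto intro!: exI[of _ "\<lambda>_ _. 0"])

lemma Ck_on_bounded_linear: "bounded_linear f \<Longrightarrow> Ck_on k f U"
proof (induction k)
  case 0
  then show ?case by (simp add: linear_continuous_on)
next
  case (Suc k)
  then show ?case
    by (auto intro!: exI[of _ "\<lambda>_. f"] bounded_linear_imp_has_derivative Ck_on_const)
qed

lemma has_derivative_lorentz_square:
  "((\<lambda>x. x \<bullet>\<^sub>L x - \<rho>) has_derivative (\<lambda>v. 2 * (y \<bullet>\<^sub>L v))) (at y)"
  using lorentz.FDERIV[OF has_derivative_ident has_derivative_ident, of y UNIV]
  by (auto intro!: derivative_eq_intros simp: lorentz_commute)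

lemma Ck_on_lorentz_square: "Ck_on k (\<lambda>x. x \<bullet>\<^sub>L x - \<rho>) U"
proof (cases k)
  case 0
  then show ?thesis by (auto intro!: continuous_intros lorentz.continuous_on)
next
  case (Suc m)
  have "Ck_on m (\<lambda>y. 2 * (y \<bullet>\<^sub>L v)) U" for v
    by (intro Ck_on_bounded_linear bounded_linear_const_mult lorentz.bounded_linear_left)
  then show ?thesis
    unfolding Suc using has_derivative_lorentz_square
    by (auto intro!: exI[of _ "\<lambda>y v. 2 * (y \<bullet>\<^sub>L v)"])
qed

lemma quadric_nonempty: "quadric \<rho> \<noteq> {}"
proof (cases "\<rho> \<ge> 0")
  case True
  then have "vector [sqrt \<rho>, 0, 0] \<in> quadric \<rho>"
    by (simp add: quadric_def lorentz_def vector_3)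
  then show ?thesis by blast
next
  case False
  then have "vector [0, 0, sqrt (- \<rho>)] \<in> quadric \<rho>"
    by (simp add: quadric_def lorentz_def vector_3)
  then show ?thesis by blast
qed

lemma quadric_surface_quadric:
  assumes "\<rho> \<noteq> 0"
  shows "quadric_surface (quadric \<rho>)"
proof -
  let ?F = "\<lambda>x::real^3. x \<bullet>\<^sub>L x - \<rho>"
  have ne: "frechet_derivative ?F (at y) \<noteq> (\<lambda>_. 0)" if "y \<in> quadric \<rho>" for y
  proof
    assume "frechet_derivative ?F (at y) = (\<lambda>_. 0)"
    then have "(\<lambda>v. 2 * (y \<bullet>\<^sub>L v)) = (\<lambda>_. 0)"
      using frechet_derivative_at[OF has_derivative_lorentz_square] by metis
    then have "2 * (y \<bullet>\<^sub>L y) = 0" by metis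
    then show False using that assms by (simp add: quadric_def)
  qed
  have "regular_surface (quadric \<rho>)"
    unfolding regular_surface_def
    using ne by (intro ballI exI[of _ UNIV] exI[of _ ?F])
      (auto simp: Ck_on_lorentz_square quadric_def)
  moreover have "\<exists>(A :: real^3^3) (w :: real^3) c. A \<noteq> 0 \<and> transpose A = A \<and>
        quadric \<rho> = {x. x \<bullet> (A *v x) + w \<bullet> x + c = 0}"
  proof (intro exI conjI)
    let ?A = "vector [vector [1, 0, 0], vector [0, 1, 0], vector [0, 0, -1]] :: real^3^3"
    show "?A \<noteq> 0" by (auto simp: vec_eq_iff forall_3 vector_3)
    show "transpose ?A = ?A" by (auto simp: vec_eq_iff forall_3 vector_3 transpose_def)
    show "quadric \<rho> = {x. x \<bullet> (?A *v x) + 0 \<bullet> x + - \<rho> = 0}"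
      by (auto simp: quadric_def lorentz_def inner_vec_def matrix_vector_mult_def sum_3 vector_3)
  qed
  ultimately show ?thesis by (simp add: quadric_surface_def quadric_nonempty)
qed

lemma nondegenerate_quadric:
  assumes "\<rho> \<noteq> 0"
  shows "nondegenerate (quadric \<rho>)"
  unfolding nondegenerate_def
proof (intro ballI impI)
  fix x v assume x: "x \<in> quadric \<rho>" and "v \<in> tangent_space (quadric \<rho>) x"
    and "\<forall>w\<in>tangent_space (quadric \<rho>) x. v \<bullet>\<^sub>L w = 0"
  then show "v = 0"
    using perp_nondegenerate[of x v] assms tangent_space_quadric[OF assms x]
    by (simp add: quadric_def)
qed

lemma unit_normal_field_quadric:
  assumes "\<rho> \<noteq> 0"
  shows "unit_normal_field (quadric \<rho>) (\<lambda>x. x /\<^sub>R sqrt \<bar>\<rho>\<bar>)"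
  unfolding unit_normal_field_def
proof (intro conjI ballI)
  show "continuous_on (quadric \<rho>) (\<lambda>x. x /\<^sub>R sqrt \<bar>\<rho>\<bar>)"
    by (intro continuous_intros)
  fix x assume x: "x \<in> quadric \<rho>"
  have "sqrt \<bar>\<rho>\<bar> * sqrt \<bar>\<rho>\<bar> = \<bar>\<rho>\<bar>" by simp
  then show "\<bar>(x /\<^sub>R sqrt \<bar>\<rho>\<bar>) \<bullet>\<^sub>L (x /\<^sub>R sqrt \<bar>\<rho>\<bar>)\<bar> = 1"
    using x assms
    by (simp add: quadric_def lorentz.scaleR_left lorentz.scaleR_right abs_mult field_simps)
  fix v assume "v \<in> tangent_space (quadric \<rho>) x"
  then show "(x /\<^sub>R sqrt \<bar>\<rho>\<bar>) \<bullet>\<^sub>L v = 0"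
    using tangent_space_quadric[OF assms x]
    by (simp add: lorentz.scaleR_left lorentz.scaleR_right lorentz_commute)
qed

text \<open>The unit normal is a multiple of the position vector, so its derivative is a multiple of the
  identity.\<close>

lemma totally_umbilical_quadric:
  assumes "\<rho> \<noteq> 0"
  shows "totally_umbilical (quadric \<rho>)"
  unfolding totally_umbilical_def
proof (intro ballI exI conjI)
  let ?M = "\<lambda>x::real^3. x /\<^sub>R sqrt \<bar>\<rho>\<bar>"
  show "open (UNIV :: (real^3) set)" by simp
  show "unit_normal_field (quadric \<rho> \<inter> UNIV) ?M"
    using unit_normal_field_quadric[OF assms] by simp
  show "(?M has_derivative ?M) (at y within quadric \<rho>)" for y
    by (intro derivative_intros)
qed auto

section \<open>Calculus on the de Sitter plane\<close>

lemma deSitter_eq_quadric: "deSitter = quadric 1"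
  by (simp add: deSitter_def quadric_def)

lemma subspace_dS_tangent: "subspace (dS_tangent p)"
  by (auto simp: subspace_def dS_tangent_def lorentz.add_left lorentz.scaleR_left
      lorentz.zero_left)

lemma dim_dS_tangent:
  assumes "p \<noteq> 0"
  shows "dim (dS_tangent p) = 2"
proof -
  let ?n = "vector [p $ 1, p $ 2, - p $ 3] :: real^3"
  have "dS_tangent p = {v. ?n \<bullet> v = 0}"
    by (auto simp: dS_tangent_def lorentz_def inner_vec_def sum_3 vector_3 mult.commute)
  moreover have "?n \<noteq> 0"
    using assms by (auto simp: vec_eq_iff forall_3 vector_3)
  ultimately show ?thesis by (simp add: dim_hyperplane)
qed

lemma deSitter_nonzero: "p \<in> deSitter \<Longrightarrow> p \<noteq> 0"
  by (auto simp: deSitter_def lorentz.zero_left)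

text \<open>A derivative within the surface is determined on tangent vectors because each of them is the
  velocity of a curve in the surface, along which the chain rule applies.\<close>

lemma dS_derivative_unique:
  assumes p: "p \<in> deSitter" and v: "v \<in> dS_tangent p"
    and D: "(f has_derivative D) (at p within deSitter)"
    and D': "(f has_derivative D') (at p within deSitter)"
  shows "D v = D' v"
proof -
  have "v \<in> tangent_space deSitter p"
    using p v tangent_space_quadric[of 1 p] by (simp add: deSitter_eq_quadric dS_tangent_def)
  then obtain c e where e: "e > 0" "c 0 = p" "\<And>t. \<bar>t\<bar> < e \<Longrightarrow> c t \<in> deSitter"
    and d: "(c has_vector_derivative v) (at (0::real))"
    unfolding tangent_space_def by blast
  let ?J = "{-e<..<e}"
  have cd: "(c has_derivative (\<lambda>t. t *\<^sub>R v)) (at 0 within ?J)"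
    using d has_vector_derivative_at_within has_vector_derivative_def by blast
  have sub: "c ` ?J \<subseteq> deSitter" using e(3) by auto
  have "((f \<circ> c) has_vector_derivative E v) (at 0 within ?J)"
    if "(f has_derivative E) (at p within deSitter)" for E
  proof -
    have "(f has_derivative E) (at (c 0) within c ` ?J)"
      using that sub e(2) by (auto intro: has_derivative_subset)
    from diff_chain_within[OF cd this]
    have "((f \<circ> c) has_derivative (E \<circ> (\<lambda>t. t *\<^sub>R v))) (at 0 within ?J)" .
    moreover have "E \<circ> (\<lambda>t. t *\<^sub>R v) = (\<lambda>t. t *\<^sub>R E v)"
      using has_derivative_linear[OF that] by (auto simp: linear_scale)
    ultimately show ?thesis by (simp add: has_vector_derivative_def)
  qed
  from this[OF D] this[OF D'] show ?thesis
    using vector_derivative_unique_within[of 0 ?J] e(1)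
    by (simp add: at_within_open[of 0 ?J])
qed

lemma has_derivative_within_cong_open:
  assumes "(f has_derivative D) (at p within S)" "open V" "p \<in> V" "p \<in> S"
    and eq: "\<And>x. x \<in> V \<Longrightarrow> x \<in> S \<Longrightarrow> g x = f x"
  shows "(g has_derivative D) (at p within S)"
proof (rule has_derivative_transform_eventually[OF assms(1)])
  show "eventually (\<lambda>x. f x = g x) (at p within S)"
    using assms unfolding eventually_at_topological by metis
qed (use assms in auto)

lemma has_derivative_dS_diff:
  "f differentiable (at p within deSitter) \<Longrightarrow>
    (f has_derivative dS_diff f p) (at p within deSitter)"
  by (simp add: dS_diff_def frechet_derivative_works[symmetric])

lemma grad_eqI:
  assumes "p \<in> deSitter" "g \<in> dS_tangent p" "\<And>v. v \<in> dS_tangent p \<Longrightarrow> g \<bullet>\<^sub>L v = dS_diff u p v"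
  shows "grad u p = g"
  unfolding grad_def
proof (rule the_equality)
  fix h assume h: "h \<in> dS_tangent p \<and> (\<forall>v\<in>dS_tangent p. h \<bullet>\<^sub>L v = dS_diff u p v)"
  have "h - g = 0"
    by (rule perp_nondegenerate[of p])
      (use assms h in \<open>auto simp: deSitter_def dS_tangent_def lorentz.diff_left\<close>)
  then show "h = g" by simp
qed (use assms in auto)

text \<open>The intrinsic gradient is the tangential projection of any ambient Lorentz gradient \<open>G\<close>. The
  derivative \<open>D\<close> need not be the one chosen by \<open>dS_diff\<close>: different choices of \<open>D\<close> change \<open>G\<close> only
  by a multiple of \<open>p\<close>.\<close>

lemma grad_eq_tangential_part:
  assumes p: "p \<in> deSitter" and D: "(u has_derivative D) (at p within deSitter)"
    and G: "\<And>v. G \<bullet>\<^sub>L v = D v"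
  shows "grad u p = G - (G \<bullet>\<^sub>L p) *\<^sub>R p"
proof (rule grad_eqI[OF p])
  show "G - (G \<bullet>\<^sub>L p) *\<^sub>R p \<in> dS_tangent p"
    using p by (simp add: dS_tangent_def deSitter_def lorentz.diff_left lorentz.scaleR_left)
  fix v assume v: "v \<in> dS_tangent p"
  have "(u has_derivative dS_diff u p) (at p within deSitter)"
    using D by (intro has_derivative_dS_diff) (auto simp: differentiable_def)
  then have "dS_diff u p v = D v"
    using dS_derivative_unique[OF p v] D by blast
  moreover have "p \<bullet>\<^sub>L v = 0"
    using v by (simp add: dS_tangent_def lorentz_commute)
  ultimately show "(G - (G \<bullet>\<^sub>L p) *\<^sub>R p) \<bullet>\<^sub>L v = dS_diff u p v"
    by (simp add: lorentz.diff_left lorentz.scaleR_left G)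
qed

lemma
  assumes p: "p \<in> deSitter" and u: "u differentiable (at p within deSitter)"
  shows grad_tangent: "grad u p \<bullet>\<^sub>L p = 0"
    and grad_lorentz: "v \<in> dS_tangent p \<Longrightarrow> grad u p \<bullet>\<^sub>L v = dS_diff u p v"
proof -
  note D = has_derivative_dS_diff[OF u]
  obtain G where G: "\<And>v. G \<bullet>\<^sub>L v = dS_diff u p v"
    using lorentz_representation[OF has_derivative_linear[OF D]] by blast
  note eq = grad_eq_tangential_part[OF p D G]
  show "grad u p \<bullet>\<^sub>L p = 0"
    using p by (simp add: eq deSitter_def lorentz.diff_left lorentz.scaleR_left)
  assume "v \<in> dS_tangent p"
  then have "p \<bullet>\<^sub>L v = 0"
    by (simp add: dS_tangent_def lorentz_commute)
  then show "grad u p \<bullet>\<^sub>L v = dS_diff u p v"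
    by (simp add: eq lorentz.diff_left lorentz.scaleR_left G)
qed

text \<open>Near \<open>p\<close>, the function \<open>u\<close> is the restriction of an ambient \<open>F\<close>, and \<open>\<nabla>u\<close> is the restriction of
  the tangential projection of the Lorentz gradient \<open>L\<close> of \<open>F\<close>. The components of \<open>L\<close> are first
  partial derivatives of \<open>F\<close>, so they are differentiable once more.\<close>

lemma C2_differentiable:
  assumes \<Omega>: "openin (top_of_set deSitter) \<Omega>" and u: "Ck_on_subset 2 u \<Omega>" and p: "p \<in> \<Omega>"
  shows "u differentiable (at p within deSitter)"
    and "grad u differentiable (at p within deSitter)"
proof -
  obtain T where T: "open T" "\<Omega> = deSitter \<inter> T"
    using \<Omega> unfolding openin_open by metis
  obtain W F where W: "open W" "p \<in> W" and F: "Ck_on 2 F W"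
    and Fu: "\<And>x. x \<in> W \<inter> \<Omega> \<Longrightarrow> F x = u x"
    using bspec[OF u[unfolded Ck_on_subset_def] p] by metis
  obtain F' where F': "\<And>x. x \<in> W \<Longrightarrow> (F has_derivative F' x) (at x)"
    and F'': "\<And>v. Ck_on 1 (\<lambda>x. F' x v) W"
    using F unfolding numeral_2_eq_2 Ck_on.simps(2)[of "Suc 0"] One_nat_def by metis
  define V where "V = W \<inter> T"
  have V: "open V" "p \<in> V" "\<And>x. x \<in> V \<inter> deSitter \<Longrightarrow> F x = u x" "V \<subseteq> W"
    using W T p Fu by (auto simp: V_def)
  have du: "(u has_derivative F' x) (at x within deSitter)" if "x \<in> V" "x \<in> deSitter" for x
  proof -
    have "(F has_derivative F' x) (at x within deSitter)"
      using F' that V(4) has_derivative_at_withinI by blast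
    then show ?thesis
      by (rule has_derivative_within_cong_open[OF _ V(1) that]) (use V(3) in auto)
  qed
  have pS: "p \<in> deSitter" using p T by blast
  show "u differentiable (at p within deSitter)"
    using du[OF V(2) pS] by (auto simp: differentiable_def)
  define L where "L x = (vector [F' x (axis 1 1), F' x (axis 2 1), - F' x (axis 3 1)] :: real^3)"
    for x
  have grad: "grad u x = L x - (L x \<bullet>\<^sub>L x) *\<^sub>R x" if "x \<in> V" "x \<in> deSitter" for x
    using lorentz_representation[OF has_derivative_linear[OF du[OF that]]]
    by (intro grad_eq_tangential_part[OF that(2) du[OF that]]) (simp add: L_def)
  have dF': "(\<lambda>x. F' x v) differentiable (at p within deSitter)" for v
    using F''[of v] W(2) by (auto simp: differentiable_def intro: has_derivative_at_withinI)
  have L_sum: "L = (\<lambda>x. F' x (axis 1 1) *\<^sub>R axis 1 1 + F' x (axis 2 1) *\<^sub>R axis 2 1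
      - F' x (axis 3 1) *\<^sub>R axis 3 1)"
    by (auto simp: L_def fun_eq_iff vec_eq_iff forall_3 axis_def vector_3)
  have "L differentiable (at p within deSitter)"
    unfolding L_sum by (intro derivative_intros dF')
  then obtain L' where L': "(L has_derivative L') (at p within deSitter)"
    by (auto simp: differentiable_def)
  obtain G' where "((\<lambda>x. L x - (L x \<bullet>\<^sub>L x) *\<^sub>R x) has_derivative G') (at p within deSitter)"
    using has_derivative_diff[OF L' has_derivative_scaleR[OF
          lorentz.FDERIV[OF L' has_derivative_ident] has_derivative_ident]] by blast
  then have "(grad u has_derivative G') (at p within deSitter)"
    by (rule has_derivative_within_cong_open[OF _ V(1,2) pS]) (use grad in auto)
  then show "grad u differentiable (at p within deSitter)"
    by (auto simp: differentiable_def)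
qed

section \<open>Regularity of the map\<close>

text \<open>A kernel vector of \<open>A\<close> yields a kernel vector of the matrix of \<open>A\<close> in every basis, so all
  these determinants vanish. At least one basis exists, so that \<open>0\<close> is the only common value. The
  vanishing in all bases avoids the invariance of the determinant under a change of basis.\<close>

lemma tangent_det_singular:
  assumes p: "p \<noteq> 0" and A: "linear A" "A ` dS_tangent p \<subseteq> dS_tangent p"
    and v: "v \<in> dS_tangent p" "v \<noteq> 0" "A v = 0"
  shows "tangent_det p A = 0"
proof -
  let ?P = "\<lambda>(e :: 2 \<Rightarrow> real^3) (M :: real^2^2).
     inj e \<and> independent (range e) \<and> span (range e) = dS_tangent p \<and>
     (\<forall>j. A (e j) = (\<Sum>i\<in>UNIV. M $ i $ j *\<^sub>R e i))"
  have coeffs: "\<exists>c. w = (\<Sum>j\<in>UNIV. c j *\<^sub>R e j)"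
    if "inj e" "span (range e) = dS_tangent p" "w \<in> dS_tangent p" for e :: "2 \<Rightarrow> real^3" and w
  proof -
    have "w \<in> range (\<lambda>c. \<Sum>b\<in>range e. c b *\<^sub>R b)"
      using that span_finite[of "range e"] by simp
    then obtain c where "w = (\<Sum>b\<in>range e. c b *\<^sub>R b)" by blast
    then have "w = (\<Sum>j\<in>UNIV. (c \<circ> e) j *\<^sub>R e j)"
      using sum.reindex[OF that(1), of "\<lambda>b. c b *\<^sub>R b"] by simp
    then show ?thesis by blast
  qed
  have det0: "det M = 0" if P: "?P e M" for e M
  proof -
    obtain c where c: "v = (\<Sum>j\<in>UNIV. c j *\<^sub>R e j)"
      using coeffs P v by blast
    let ?c = "\<chi> j. c j"
    have "A v = (\<Sum>j\<in>UNIV. c j *\<^sub>R A (e j))"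
      using A(1) by (simp add: c linear_sum linear_scale)
    also have "\<dots> = (\<Sum>j\<in>UNIV. \<Sum>i\<in>UNIV. (M $ i $ j * c j) *\<^sub>R e i)"
      using P by (simp add: scaleR_sum_right mult.commute)
    also have "\<dots> = (\<Sum>i\<in>UNIV. (M *v ?c) $ i *\<^sub>R e i)"
      by (subst sum.swap) (simp add: matrix_vector_mult_def scaleR_sum_left)
    finally have "(\<Sum>i\<in>UNIV. (M *v ?c) $ i *\<^sub>R e i) = 0" using v by simp
    then have "(\<Sum>b\<in>range e. (M *v ?c) $ (inv e b) *\<^sub>R b) = 0"
      using P by (simp add: sum.reindex)
    then have "(M *v ?c) $ (inv e (e i)) = 0" for i
      using P by (intro independentD[of "range e" "range e"]) auto
    then have "M *v ?c = 0" using P by (simp add: vec_eq_iff)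
    moreover have "?c \<noteq> 0"
    proof
      assume "?c = 0"
      then have "c j = 0" for j by (simp add: vec_eq_iff)
      then show False using v(2) c by simp
    qed
    ultimately show ?thesis
      using invertible_det_nz invertible_left_inverse matrix_left_invertible_ker by blast
  qed
  obtain B where B: "B \<subseteq> dS_tangent p" "independent B" "dS_tangent p \<subseteq> span B"
    "card B = dim (dS_tangent p)"
    by (rule basis_exists)
  have "finite B" "card B = CARD(2)"
    using B dim_dS_tangent[OF p] independent_imp_finite by auto
  then obtain e :: "2 \<Rightarrow> real^3" where "bij_betw e UNIV B"
    using finite_same_card_bij[of "UNIV :: 2 set" B] by auto
  then have e: "inj e" "range e = B" by (auto simp: bij_betw_def)
  have span: "span B = dS_tangent p"
    using B subspace_dS_tangent by (metis span_minimal subset_antisym)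
  have "\<exists>c. A (e j) = (\<Sum>i\<in>UNIV. c i *\<^sub>R e i)" for j
    using coeffs e span A(2) B(1) by blast
  then obtain m where m: "\<And>j. A (e j) = (\<Sum>i\<in>UNIV. m j i *\<^sub>R e i)" by metis
  have P: "?P e (\<chi> i j. m j i)" using e span B m by simp
  show ?thesis
    unfolding tangent_det_def
  proof (rule the_equality)
    fix d assume "\<forall>e M. ?P e M \<longrightarrow> det M = d"
    then show "d = 0" using P det0 by blast
  qed (use det0 in blast)
qed

lemma timelike_tangent_vector:
  assumes "p \<in> deSitter"
  obtains w where "w \<in> dS_tangent p" "w \<bullet>\<^sub>L w < 0"
proof
  let ?s = "(p $ 1)\<^sup>2 + (p $ 2)\<^sup>2"
  \<comment> \<open>A tangent vector of the meridian of the hyperboloid through \<open>p\<close>.\<close>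
  let ?w = "vector [p $ 1 * p $ 3, p $ 2 * p $ 3, ?s] :: real^3"
  show "?w \<in> dS_tangent p"
    by (simp add: dS_tangent_def lorentz_def vector_3 power2_eq_square algebra_simps)
  have s: "?s = 1 + (p $ 3)\<^sup>2"
    using assms by (simp add: deSitter_def lorentz_def power2_eq_square)
  have "?w \<bullet>\<^sub>L ?w = ?s * ((p $ 3)\<^sup>2 - ?s)"
    by (simp add: lorentz_def vector_3 power2_eq_square algebra_simps)
  also have "\<dots> = - ?s" using s by simp
  also have "\<dots> < 0" using s by (smt (verit) zero_le_power2)
  finally show "?w \<bullet>\<^sub>L ?w < 0" .
qed

text \<open>On tangent vectors the derivative \<open>?D\<close> of \<open>X_u\<close> agrees with \<open>?A = Hess u + u Id\<close>, which maps
  the tangent plane to itself. Regularity makes \<open>?A\<close> injective, hence also surjective there, and a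
  timelike tangent vector is in its image.\<close>

lemma timelike_immersion_X_map:
  assumes \<Omega>: "openin (top_of_set deSitter) \<Omega>" and u: "Ck_on_subset 2 u \<Omega>" and p: "p \<in> \<Omega>"
    and reg: "X_regular_at u p"
  shows "timelike_immersion_with_normal_at (X_map u) p p"
proof -
  have sub: "\<Omega> \<subseteq> deSitter" using \<Omega> openin_imp_subset by blast
  have pS: "p \<in> deSitter" and pp: "p \<bullet>\<^sub>L p = 1" using p sub by (auto simp: deSitter_def)
  let ?g = "dS_diff (grad u) p" and ?T = "dS_tangent p"
  note du = C2_differentiable(1)[OF \<Omega> u] and dg = C2_differentiable(2)[OF \<Omega> u]
  note Du = has_derivative_dS_diff[OF du[OF p]] and Dg = has_derivative_dS_diff[OF dg[OF p]]
  \<comment> \<open>Differentiate \<open>\<nabla>u(x) \<bullet>\<^sub>L x = 0\<close> along the surface.\<close>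
  have normal_part: "?g v \<bullet>\<^sub>L p = - dS_diff u p v" if v: "v \<in> ?T" for v
  proof -
    obtain T where T: "open T" "\<Omega> = deSitter \<inter> T" using \<Omega> unfolding openin_open by metis
    have "((\<lambda>x. grad u x \<bullet>\<^sub>L x) has_derivative (\<lambda>v. grad u p \<bullet>\<^sub>L v + ?g v \<bullet>\<^sub>L p))
        (at p within deSitter)"
      by (rule lorentz.FDERIV[OF Dg has_derivative_ident])
    moreover have "((\<lambda>x. grad u x \<bullet>\<^sub>L x) has_derivative (\<lambda>_. 0)) (at p within deSitter)"
      by (rule has_derivative_within_cong_open[OF has_derivative_const[of 0] T(1) _ pS])
        (use p T(2) grad_tangent du in auto)
    ultimately have "grad u p \<bullet>\<^sub>L v + ?g v \<bullet>\<^sub>L p = 0"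
      using dS_derivative_unique[OF pS v] by blast
    then show ?thesis using grad_lorentz[OF pS du[OF p] v] by simp
  qed
  let ?D = "\<lambda>v. u p *\<^sub>R v + dS_diff u p v *\<^sub>R p + ?g v"
  let ?A = "\<lambda>v. Hess u p v + u p *\<^sub>R v"
  have DX: "(X_map u has_derivative ?D) (at p within deSitter)"
    unfolding X_map_def[abs_def]
    by (intro has_derivative_add has_derivative_scaleR Du Dg has_derivative_ident)
  have DA: "?D v = ?A v" if "v \<in> ?T" for v
    using normal_part[OF that] by (simp add: Hess_def dS_conn_def)
  have AT: "?A v \<in> ?T" if "v \<in> ?T" for v
    using that pp
    by (simp add: dS_tangent_def Hess_def dS_conn_def lorentz.add_left lorentz.diff_left
        lorentz.scaleR_left)
  have "linear ?g" using has_derivative_linear[OF Dg] .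
  then have linA: "linear ?A"
    by (intro linearI) (simp_all add: Hess_def dS_conn_def linear_add linear_scale
        lorentz.add_left lorentz.scaleR_left algebra_simps)
  have ker: "v = 0" if "v \<in> ?T" "?A v = 0" for v
    using tangent_det_singular[OF deSitter_nonzero[OF pS] linA] AT that reg
    unfolding X_regular_at_def by blast
  have injA: "inj_on ?A ?T"
    using linear_inj_on_iff_eq_0[OF linA subspace_dS_tangent] ker by blast
  have injD: "inj_on ?D ?T" by (rule iffD2[OF inj_on_cong[of ?T ?D ?A, OF DA] injA])
  obtain w where w: "w \<in> ?T" "w \<bullet>\<^sub>L w < 0" using timelike_tangent_vector[OF pS] .
  have "?A ` ?T = ?T"
  proof (rule subspace_dim_equal)
    show "subspace (?A ` ?T)" by (rule linear_subspace_image[OF linA subspace_dS_tangent])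
    have span: "span ?T = ?T" using subspace_dS_tangent by (simp add: span_eq_iff)
    show "dim ?T \<le> dim (?A ` ?T)"
      using dim_image_eq[OF linA, of ?T, unfolded span, OF injA] by (rule eq_imp_le[OF sym])
    show "?A ` ?T \<subseteq> ?T" by (rule image_subsetI) (rule AT)
  qed (rule subspace_dS_tangent)
  then have "w \<in> ?A ` ?T" using w(1) by (rule ssubst)
  then obtain v where "v \<in> ?T" "w = ?A v" by (rule imageE)
  then have "?D v \<bullet>\<^sub>L ?D v < 0" using w(2) by (simp only: DA)
  then have "\<exists>v\<in>?T. ?D v \<bullet>\<^sub>L ?D v < 0" using \<open>v \<in> ?T\<close> by (rule bexI)
  moreover have "p \<bullet>\<^sub>L ?D v = 0" if "v \<in> ?T" for v
    using AT[OF that] unfolding DA[OF that] dS_tangent_def by (simp add: lorentz_commute)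
  ultimately show ?thesis
    unfolding timelike_immersion_with_normal_at_def using DX injD pp
    by (intro exI[of _ ?D]) simp
qed

section \<open>Boundary data along the curve\<close>

text \<open>The component of \<open>\<nabla>u\<close> along \<open>\<nu>\<close> is \<open>\<delta> b\<close> rather than \<open>b\<close>, since \<open>\<nu>\<close> has square \<open>\<delta>\<close>; its
  square contributes \<open>\<delta> (\<delta> b)\<^sup>2 = \<delta> b\<^sup>2\<close>.\<close>

lemma X_map_in_quadric:
  assumes curve: "noncharacteristic_curve I \<gamma>" and co: "unit_conormal I \<gamma> \<delta> \<nu>"
    and \<delta>: "\<delta> \<in> {-1, 1}" and t: "t \<in> I"
    and du: "u differentiable (at (\<gamma> t) within deSitter)"
    and a: "\<forall>t\<in>I. u (\<gamma> t) = a" and b: "dS_diff u (\<gamma> t) (\<nu> t) = b"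
  shows "X_map u (\<gamma> t) \<in> quadric (a\<^sup>2 + \<delta> * b\<^sup>2)"
proof -
  let ?p = "\<gamma> t" and ?n = "\<nu> t"
  define T where "T = vector_derivative \<gamma> (at t within I)"
  have I: "is_interval I" "interior I \<noteq> {}" and \<gamma>: "\<gamma> ` I \<subseteq> deSitter"
    and d\<gamma>: "(\<gamma> has_vector_derivative T) (at t within I)" and TT: "T \<bullet>\<^sub>L T \<noteq> 0"
    using curve t by (auto simp: noncharacteristic_curve_def T_def vector_derivative_works)
  \<comment> \<open>The parameter is not isolated in the interval, so derivatives within it are unique.\<close>
  have nontriv: "at t within I \<noteq> bot"
  proof -
    have "connected I" "\<nexists>x. I = {x}"
      using I is_interval_connected by (auto simp: interior_singleton)
    then show ?thesis
      using connected_imp_perfect[of I t] t by (simp add: trivial_limit_within)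
  qed
  have pS: "?p \<in> deSitter" and pp: "?p \<bullet>\<^sub>L ?p = 1" using \<gamma> t by (auto simp: deSitter_def)
  have Tp: "T \<bullet>\<^sub>L ?p = 0"
    by (rule quadric_curve_normal[OF t nontriv _ d\<gamma>, of 1])
      (use \<gamma> in \<open>auto simp: deSitter_eq_quadric\<close>)
  have np: "?n \<bullet>\<^sub>L ?p = 0" and nT: "?n \<bullet>\<^sub>L T = 0" and nn: "?n \<bullet>\<^sub>L ?n = \<delta>"
    using co t by (auto simp: unit_conormal_def dS_tangent_def T_def)
  have "dS_diff u ?p T = 0"
  proof -
    have "(u has_derivative dS_diff u ?p) (at ?p within \<gamma> ` I)"
      using has_derivative_dS_diff[OF du] \<gamma> by (rule has_derivative_subset)
    from diff_chain_within[OF d\<gamma>[unfolded has_vector_derivative_def] this]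
    have "((u \<circ> \<gamma>) has_vector_derivative dS_diff u ?p T) (at t within I)"
      using has_derivative_linear[OF has_derivative_dS_diff[OF du]]
      by (simp add: has_vector_derivative_def o_def linear_scale)
    moreover have "((u \<circ> \<gamma>) has_vector_derivative 0) (at t within I)"
      by (rule has_vector_derivative_transform[OF t _ has_vector_derivative_const[of a]])
        (use a in auto)
    ultimately show ?thesis
      using vector_derivative_unique_within[OF nontriv] by blast
  qed
  let ?g = "grad u ?p"
  have gp: "?g \<bullet>\<^sub>L ?p = 0" using grad_tangent[OF pS du] .
  have gT: "?g \<bullet>\<^sub>L T = 0" and gn: "?g \<bullet>\<^sub>L ?n = b"
    using grad_lorentz[OF pS du] \<open>dS_diff u ?p T = 0\<close> b Tp np by (simp_all add: dS_tangent_def)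
  have \<delta>\<delta>: "\<delta> * \<delta> = 1" using \<delta> by auto
  have "?g - (\<delta> * b) *\<^sub>R ?n = 0"
  proof (rule orthogonal_to_frame_eq_0[of ?p T ?n])
    show "?p \<bullet>\<^sub>L T = 0" "?p \<bullet>\<^sub>L ?n = 0" "T \<bullet>\<^sub>L ?n = 0"
      using Tp np nT by (simp_all add: lorentz_commute)
  qed (use pp TT nn \<delta> gp gT gn np nT \<delta>\<delta> in
      \<open>auto simp: lorentz.diff_left lorentz.scaleR_left\<close>)
  then have "?g \<bullet>\<^sub>L ?g = (\<delta> * b) * b" using gn
    by (metis eq_iff_diff_eq_0 lorentz.scaleR_left lorentz_commute real_scaleR_def)
  then show ?thesis
    using a t pp gp
    by (simp add: quadric_def X_map_def lorentz.add_left lorentz.add_right lorentz.scaleR_left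
        lorentz.scaleR_right lorentz_commute[of ?p ?g] power2_eq_square)
qed

theorem proposition4p2:
  fixes u :: "real^3 \<Rightarrow> real" and \<Omega> :: "(real^3) set"
    and I :: "real set" and \<gamma> \<nu> :: "real \<Rightarrow> real^3"
    and a b \<delta> \<rho> :: real
  assumes "openin (top_of_set deSitter) \<Omega>" and "connected \<Omega>"
    and "Ck_on_subset 2 u \<Omega>"
    and "\<forall>p\<in>\<Omega>. dAlembertian u p + 2 * u p = 0"
    and "noncharacteristic_curve I \<gamma>" and "\<gamma> ` I \<subseteq> \<Omega>"
    and "unit_conormal I \<gamma> \<delta> \<nu>" and "\<delta> \<in> {-1, 1}"
    and "\<forall>t\<in>I. u (\<gamma> t) = a"
    and "\<forall>t\<in>I. dS_diff u (\<gamma> t) (\<nu> t) = b"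
    and "\<rho> = a\<^sup>2 + \<delta> * b\<^sup>2"
  shows "X_map u ` regular_part u (\<gamma> ` I) \<subseteq> quadric \<rho> \<and>
    (\<rho> \<noteq> 0 \<longrightarrow>
       quadric_surface (quadric \<rho>) \<and> nondegenerate (quadric \<rho>) \<and> totally_umbilical (quadric \<rho>) \<and>
       meets_at_constant_angle (X_map u) (\<lambda>p. p) (regular_part u (\<gamma> ` I))
         (quadric \<rho>) (\<lambda>x. x /\<^sub>R sqrt \<bar>\<rho>\<bar>)) \<and>
    (\<rho> = 0 \<longrightarrow> X_map u ` regular_part u (\<gamma> ` I) \<subseteq> light_cone)"
proof -
  let ?C = "regular_part u (\<gamma> ` I)"
  have du: "u differentiable (at (\<gamma> t) within deSitter)" if "t \<in> I" for t
    using C2_differentiable(1) assms(1,3,6) that by blast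
  have image: "X_map u ` ?C \<subseteq> quadric \<rho>"
    using X_map_in_quadric[OF assms(5,7,8) _ du assms(9)] assms(10,11)
    by (auto simp: regular_part_def)
  have C: "p \<in> deSitter" "u differentiable (at p within deSitter)" "u p = a"
    "timelike_immersion_with_normal_at (X_map u) p p" if "p \<in> ?C" for p
    using that du timelike_immersion_X_map[OF assms(1,3)] assms(1,6,9)
    by (auto simp: regular_part_def openin_open)
  have "p \<bullet>\<^sub>L (X_map u p /\<^sub>R sqrt \<bar>\<rho>\<bar>) = a / sqrt \<bar>\<rho>\<bar>" if "p \<in> ?C" for p
    using C(1,3)[OF that] grad_tangent[OF C(1,2)[OF that]]
    by (simp add: X_map_def lorentz_commute[of p "grad u p"] lorentz.add_right
        lorentz.scaleR_right deSitter_def divide_inverse mult.commute)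
  then have "meets_at_constant_angle (X_map u) (\<lambda>p. p) ?C (quadric \<rho>) (\<lambda>x. x /\<^sub>R sqrt \<bar>\<rho>\<bar>)"
    if "\<rho> \<noteq> 0"
    unfolding meets_at_constant_angle_def
    using C(4) unit_normal_field_quadric[OF that] image by blast
  then show ?thesis
    using image quadric_surface_quadric nondegenerate_quadric totally_umbilical_quadric
    by (auto simp: quadric_def light_cone_def)
qed

end
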